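(* Consider the erosion network process with parameter $\eta>0$ defined in the context. For each node $v\in\mathbb{Z}^2_{even}$, almost surely the asymptotic switching rate $\lim_{n\to\infty}S_v(n)$ is nonzero. Therefore, for each $v$, almost surely both states are recurrent, i.e. $v$ chooses left ($D_v^L(n)=1$) for infinitely many $n$ and chooses right ($D_v^L(n)=0$) for infinitely many $n$.
   Context: Model. Fix $\eta>0$. Nodes are the points of $\mathbb{Z}^2_{even}=\{(x,y)\in\mathbb{Z}^2: x+y\text{ even},\ y\le 0\}$. A node $v=(x,y)$ has depth $1-y$; if its depth is at least 2 it has left parent $w_1=(x-1,y+1)$ and right parent $w_2=(x+1,y+1)$. For every node $v$ set $T_v^L(0)=T_v(0)=0$, $I_v(0)=1$, $P_v^L(0)=1/2$. For $n\ge1$, given $\mathcal{F}_{n-1}=\sigma(\{D_u^L(k): u\in\mathbb{Z}^2_{even},\,1\le k\le n-1\})$, the variables $\{D_v^L(n)\}_v$ are conditionally independent Bernoulli ($\{0,1\}$-valued) with $\mathbb{P}(D_v^L(n)=1\mid\mathcal{F}_{n-1})=P_v^L(n-1)$; $D_v^L(n)=1$ means that $v$ chooses left (L) at time $n$, and $D_v^L(n)=0$ that it chooses right (R). Then $$T_v^L(n)=T_v^L(n-1)+I_v(n-1)D_v^L(n),\quad T_v(n)=T_v(n-1)+I_v(n-1),\quad P_v^L(n)=\frac{T_v^L(n)+\eta}{T_v(n)+2\eta},$$ and $I_v(n)=1$ if $v$ has depth 1, while otherwise $I_v(n)=I_{w_1}(n-1)(1-D_{w_1}^L(n))+I_{w_2}(n-1)D_{w_2}^L(n)+1$.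 Switching rate. For $n\ge2$, $s_v(n)=D_v^L(n)(1-D_v^L(n-1))+D_v^L(n-1)(1-D_v^L(n))$ and $S_v(n)=\frac{1}{n-1}\sum_{i=2}^n s_v(i)$. The limit $\lim_{n\to\infty}S_v(n)$ exists almost surely. *)

theory Defs
  imports "HOL-Probability.Probability"
begin

type_synonym node = "int \<times> int"

definition Z2_even :: "node set" where
  "Z2_even = {(x, y). even (x + y) \<and> y \<le> 0}"

definition depth :: "node \<Rightarrow> int" where
  "depth v = 1 - snd v"

definition left_parent :: "node \<Rightarrow> node" where
  "left_parent v = (fst v - 1, snd v + 1)"

definition right_parent :: "node \<Rightarrow> node" where
  "right_parent v = (fst v + 1, snd v + 1)"

text \<open>The choice \<open>D v n \<omega>\<close> is \<open>1\<close> for left and \<open>0\<close> for right. It is meaningful only for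
  \<open>v \<in> Z2_even\<close> and \<open>n \<ge> 1\<close>; the values \<open>D v 0\<close> are never used.\<close>

fun I_flow :: "(node \<Rightarrow> nat \<Rightarrow> 'a \<Rightarrow> real) \<Rightarrow> node \<Rightarrow> nat \<Rightarrow> 'a \<Rightarrow> real" where
  "I_flow D v 0 \<omega> = 1"
| "I_flow D v (Suc n) \<omega> =
     (if depth v = 1 then 1
      else I_flow D (left_parent v) n \<omega> * (1 - D (left_parent v) (Suc n) \<omega>)
         + I_flow D (right_parent v) n \<omega> * D (right_parent v) (Suc n) \<omega> + 1)"

fun T_left :: "(node \<Rightarrow> nat \<Rightarrow> 'a \<Rightarrow> real) \<Rightarrow> node \<Rightarrow> nat \<Rightarrow> 'a \<Rightarrow> real" where
  "T_left D v 0 \<omega> = 0"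
| "T_left D v (Suc n) \<omega> = T_left D v n \<omega> + I_flow D v n \<omega> * D v (Suc n) \<omega>"

fun T_total :: "(node \<Rightarrow> nat \<Rightarrow> 'a \<Rightarrow> real) \<Rightarrow> node \<Rightarrow> nat \<Rightarrow> 'a \<Rightarrow> real" where
  "T_total D v 0 \<omega> = 0"
| "T_total D v (Suc n) \<omega> = T_total D v n \<omega> + I_flow D v n \<omega>"

text \<open>At \<open>n = 0\<close> this is \<open>\<eta> / (2 * \<eta>) = 1 / 2\<close>.\<close>

definition P_left ::
  "real \<Rightarrow> (node \<Rightarrow> nat \<Rightarrow> 'a \<Rightarrow> real) \<Rightarrow> node \<Rightarrow> nat \<Rightarrow> 'a \<Rightarrow> real" where
  "P_left \<eta> D v n \<omega> = (T_left D v n \<omega> + \<eta>) / (T_total D v n \<omega> + 2 * \<eta>)"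

definition history :: "'a measure \<Rightarrow> (node \<Rightarrow> nat \<Rightarrow> 'a \<Rightarrow> real) \<Rightarrow> nat \<Rightarrow> 'a measure" where
  "history M D n =
     sigma (space M)
       {D u k -` B \<inter> space M | u k B. u \<in> Z2_even \<and> 1 \<le> k \<and> k \<le> n \<and> B \<in> sets borel}"

definition cond_indep_vars ::
  "'a measure \<Rightarrow> 'a measure \<Rightarrow> ('i \<Rightarrow> 'b measure) \<Rightarrow> ('i \<Rightarrow> 'a \<Rightarrow> 'b) \<Rightarrow> 'i set \<Rightarrow> bool" where
  "cond_indep_vars M F N X I \<longleftrightarrow>
     (\<forall>i\<in>I. X i \<in> measurable M (N i)) \<and>
     (\<forall>J\<subseteq>I. finite J \<longrightarrow> (\<forall>B. (\<forall>j\<in>J. B j \<in> sets (N j)) \<longrightarrow>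
        (AE \<omega> in M.
           real_cond_exp M F (indicator {\<omega> \<in> space M. \<forall>j\<in>J. X j \<omega> \<in> B j}) \<omega> =
           (\<Prod>j\<in>J. real_cond_exp M F (indicator {\<omega> \<in> space M. X j \<omega> \<in> B j}) \<omega>))))"

locale erosion_network = prob_space M
  for M :: "'a measure" and \<eta> :: real and D :: "node \<Rightarrow> nat \<Rightarrow> 'a \<Rightarrow> real" +
  assumes eta_pos: "\<eta> > 0"
    and D_measurable: "\<And>v n. v \<in> Z2_even \<Longrightarrow> n \<ge> 1 \<Longrightarrow> D v n \<in> borel_measurable M"
    and D_values: "\<And>v n \<omega>. v \<in> Z2_even \<Longrightarrow> n \<ge> 1 \<Longrightarrow> \<omega> \<in> space M \<Longrightarrow> D v n \<omega> \<in> {0, 1}"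
    and D_cond_indep:
      "\<And>n. n \<ge> 1 \<Longrightarrow>
         cond_indep_vars M (history M D (n - 1)) (\<lambda>_. borel) (\<lambda>v. D v n) Z2_even"
    and D_cond_prob:
      "\<And>v n. v \<in> Z2_even \<Longrightarrow> n \<ge> 1 \<Longrightarrow>
         AE \<omega> in M.
           real_cond_exp M (history M D (n - 1)) (indicator {\<omega> \<in> space M. D v n \<omega> = 1}) \<omega> =
           P_left \<eta> D v (n - 1) \<omega>"
begin

lemma subalgebra_history: "subalgebra M (history M D n)"
proof -
  have "{D u k -` B \<inter> space M | u k B. u \<in> Z2_even \<and> 1 \<le> k \<and> k \<le> n \<and> B \<in> sets borel}
          \<subseteq> sets M"
    using D_measurable by (auto intro: measurable_sets)
  then show ?thesis
    unfolding subalgebra_def history_def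
    by (auto simp: space_measure_of_conv sets_measure_of_conv dest: sets.sigma_sets_subset)
qed

end

definition switch :: "(node \<Rightarrow> nat \<Rightarrow> 'a \<Rightarrow> real) \<Rightarrow> node \<Rightarrow> nat \<Rightarrow> 'a \<Rightarrow> real" where
  "switch D v n \<omega> =
     D v n \<omega> * (1 - D v (n - 1) \<omega>) + D v (n - 1) \<omega> * (1 - D v n \<omega>)"

definition switching_rate :: "(node \<Rightarrow> nat \<Rightarrow> 'a \<Rightarrow> real) \<Rightarrow> node \<Rightarrow> nat \<Rightarrow> 'a \<Rightarrow> real" where
  "switching_rate D v n \<omega> = (1 / (real n - 1)) * (\<Sum>i = 2..n. switch D v i \<omega>)"

end

theory Submission
  imports Defs
begin

text \<open>
  The choices of a single node form a two-colour urn whose reinforcements \<open>W n\<close> are random but known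
  before the draw, and lie between \<open>1\<close> and a constant \<open>C\<close> depending only on the depth. With \<open>X n\<close>
  and \<open>Y n\<close> the weights of the left colour and of both colours, \<open>P n = X n / Y n\<close> is a martingale with
  increments \<open>O(1/n)\<close>, hence converges almost surely to some \<open>p\<close>. The martingale law of large
  numbers gives limits \<open>p\<close> and \<open>p\<^sup>2\<close> for the averages of \<open>D n\<close> and of \<open>D (n+1) D n\<close>, so the
  switching rate tends to \<open>2 p (1 - p)\<close>. Finally \<open>C / X n - ln (P n)\<close> is a nonnegative
  supermartingale, so by Fatou's lemma \<open>p > 0\<close> almost surely; exchanging left and right, \<open>p < 1\<close>.
\<close>

subsection \<open>Averages of real sequences\<close>

lemma cesaro_mean_tendsto:
  fixes f :: "nat \<Rightarrow> real"
  assumes "f \<longlonglongrightarrow> L"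
  shows "(\<lambda>n. (\<Sum>i<n. f i) / real n) \<longlonglongrightarrow> L"
proof (rule LIMSEQ_I)
  fix e :: real assume e: "e > 0"
  obtain N where N: "\<And>i. i \<ge> N \<Longrightarrow> \<bar>f i - L\<bar> < e / 2"
    using LIMSEQ_D[OF assms, of "e / 2"] e by auto
  define K where "K = (\<Sum>i<N. \<bar>f i - L\<bar>)"
  obtain N' where N': "real N' > 2 * K / e"
    using reals_Archimedean2 by blast
  have "\<bar>(\<Sum>i<n. f i) / real n - L\<bar> < e" if n: "n \<ge> max (Suc N) N'" for n
  proof -
    have n0: "n > 0" "N \<le> n" using n by auto
    have "2 * K / e < real n" using N' n by linarith
    then have K: "K < real n * (e / 2)"
      using e by (simp add: field_simps)
    have "\<bar>(\<Sum>i<n. f i) - real n * L\<bar> = \<bar>\<Sum>i<n. f i - L\<bar>"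
      by (simp add: sum_subtractf)
    also have "\<dots> \<le> (\<Sum>i<n. \<bar>f i - L\<bar>)"
      by (rule sum_abs)
    also have "\<dots> = K + (\<Sum>i=N..<n. \<bar>f i - L\<bar>)"
      unfolding K_def using sum.atLeastLessThan_concat[of 0 N n "\<lambda>i. \<bar>f i - L\<bar>"] n0
      by (simp add: atLeast0LessThan)
    also have "(\<Sum>i=N..<n. \<bar>f i - L\<bar>) \<le> (\<Sum>i=N..<n. e / 2)"
      by (intro sum_mono) (use N in \<open>auto intro: less_imp_le\<close>)
    also have "(\<Sum>i=N..<n. e / 2) \<le> real n * (e / 2)"
      using e n0 by (simp add: field_simps)
    finally have "\<bar>(\<Sum>i<n. f i) - real n * L\<bar> < real n * e"
      using K by linarith
    moreover have "(\<Sum>i<n. f i) / real n - L = ((\<Sum>i<n. f i) - real n * L) / real n"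
      using n0 by (simp add: field_simps)
    then have "\<bar>(\<Sum>i<n. f i) / real n - L\<bar> = \<bar>(\<Sum>i<n. f i) - real n * L\<bar> / real n"
      by (simp add: abs_divide)
    ultimately show ?thesis
      using n0 by (simp add: field_simps)
  qed
  then show "\<exists>no. \<forall>n\<ge>no. norm ((\<Sum>i<n. f i) / real n - L) < e"
    by (intro exI[of _ "max (Suc N) N'"]) auto
qed

text \<open>Shifting the sequence removes the single term \<open>f 0\<close> and rescales by (n + 1)
  / n, and neither affects the limit of the averages.\<close>

lemma mean_tendsto_Suc:
  fixes f :: "nat \<Rightarrow> real"
  assumes "(\<lambda>n. (\<Sum>i<n. f i) / real n) \<longlonglongrightarrow> L"
  shows "(\<lambda>n. (\<Sum>i<n. f (Suc i)) / real n) \<longlonglongrightarrow> L"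
proof -
  have "(\<lambda>n. (\<Sum>i<Suc n. f i) / real (Suc n) * (real (Suc n) / real n) - f 0 / real n) \<longlonglongrightarrow> L * 1 - 0"
    by (intro tendsto_diff tendsto_mult LIMSEQ_Suc[OF assms] LIMSEQ_Suc_n_over_n
        tendsto_divide_0[OF tendsto_const] filterlim_at_top_imp_at_infinity filterlim_real_sequentially)
  moreover have "eventually (\<lambda>n. (\<Sum>i<Suc n. f i) / real (Suc n) * (real (Suc n) / real n) - f 0 / real n
      = (\<Sum>i<n. f (Suc i)) / real n) sequentially"
    using eventually_gt_at_top[of 0]
  proof eventually_elim
    case (elim n)
    have "(\<Sum>i<Suc n. f i) / real (Suc n) * (real (Suc n) / real n) = (\<Sum>i<Suc n. f i) / real n"
      by (simp del: of_nat_Suc)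
    then show ?case
      by (simp only: sum.lessThan_Suc_shift add_divide_distrib)
  qed
  ultimately show ?thesis
    by (simp add: tendsto_cong)
qed

text \<open>If \<open>c\<close> occurred only finitely often, the sequence would be eventually equal
  to \<open>d\<close>, and its averages would tend to \<open>d\<close> instead of \<open>p\<close>.
  Recurrence of the two choices follows from the cases (1, 0) and (0, 1).\<close>

lemma infinite_values_of_mean:
  fixes f :: "nat \<Rightarrow> real"
  assumes mean: "(\<lambda>n. (\<Sum>i<n. f (Suc i)) / real n) \<longlonglongrightarrow> p"
    and vals: "\<And>n. n \<ge> 1 \<Longrightarrow> f n \<in> {c, d}" and "p \<noteq> d"
  shows "infinite {n. n \<ge> 1 \<and> f n = c}"
proof
  assume "finite {n. n \<ge> 1 \<and> f n = c}"
  then obtain N where N: "\<And>n. n \<ge> 1 \<Longrightarrow> f n = c \<Longrightarrow> n < N"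
    using finite_nat_set_iff_bounded by auto
  have "eventually (\<lambda>i. f (Suc i) = d) sequentially"
    using eventually_ge_at_top[of N]
  proof eventually_elim
    case (elim i)
    then show ?case using N[of "Suc i"] vals[of "Suc i"] by auto
  qed
  then have "(\<lambda>i. f (Suc i)) \<longlonglongrightarrow> d"
    by (rule tendsto_eventually)
  then have "p = d"
    using LIMSEQ_unique[OF mean cesaro_mean_tendsto] by blast
  then show False using \<open>p \<noteq> d\<close> by simp
qed

text \<open>Kronecker's lemma for the weights i + 1. Summation by parts writes the average of
  \<open>b\<close> as a partial sum of the series minus the average of the earlier partial sums, and
  both have the same limit.\<close>

lemma kronecker_mean_tendsto_0:
  fixes b :: "nat \<Rightarrow> real"
  assumes "convergent (\<lambda>n. \<Sum>i<n. b i / real (Suc i))"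
  shows "(\<lambda>n. (\<Sum>i<n. b i) / real n) \<longlonglongrightarrow> 0"
proof -
  define s where "s = (\<lambda>n. \<Sum>i<n. b i / real (Suc i))"
  obtain L where L: "s \<longlonglongrightarrow> L"
    using assms unfolding s_def convergent_def by blast
  have parts: "(\<Sum>i<n. b i) = real n * s n - (\<Sum>i<n. s i)" for n
  proof (induction n)
    case (Suc n)
    have "s (Suc n) = s n + b n / real (Suc n)"
      by (simp add: s_def)
    then have "b n = real (Suc n) * (s (Suc n) - s n)"
      by (simp del: of_nat_Suc)
    then show ?case using Suc by (simp add: algebra_simps)
  qed (simp add: s_def)
  have "(\<lambda>n. s n - (\<Sum>i<n. s i) / real n) \<longlonglongrightarrow> L - L"
    by (intro tendsto_diff L cesaro_mean_tendsto)
  moreover have "eventually (\<lambda>n. s n - (\<Sum>i<n. s i) / real n = (\<Sum>i<n. b i) / real n) sequentially"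
    using eventually_gt_at_top[of 0] by eventually_elim (simp add: parts field_simps)
  ultimately show ?thesis
    by (simp add: tendsto_cong)
qed

text \<open>Summability of the block sums gives convergence along the cubes. The block starting at
  m^3 has at most 7 m^2 terms of size at most C / m^3, so inside it the partial sums move by at most
  7 C / m.\<close>

lemma convergent_of_cube_blocks:
  fixes z :: "nat \<Rightarrow> real"
  assumes bound: "\<And>i. \<bar>z i\<bar> \<le> C / real (Suc i)"
    and blocks: "summable (\<lambda>k. \<bar>\<Sum>i=(Suc k)^3..<(Suc (Suc k))^3. z i\<bar>)"
  shows "convergent (\<lambda>n. \<Sum>i<n. z i)"
proof -
  define N :: "nat \<Rightarrow> nat" where "N k = (Suc k)^3" for k
  define s where "s n = (\<Sum>i<n. z i)" for n
  have C0: "C \<ge> 0" using bound[of 0] by simp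
  have split: "s n = s m + (\<Sum>i=m..<n. z i)" if "m \<le> n" for m n
    using sum.atLeastLessThan_concat[of 0 m n z] that by (simp add: s_def atLeast0LessThan)
  have N_mono: "N k \<le> N (Suc k)" for k
    unfolding N_def by (intro power_mono) auto
  \<comment> \<open>The first block starts at \<open>N 0 = 1\<close>, so the term of index 0 stays
    outside all blocks and is carried by \<open>s 1\<close>.\<close>
  have sN: "s (N k) = s 1 + (\<Sum>j<k. \<Sum>i=N j..<N (Suc j). z i)" for k
  proof (induction k)
    case (Suc k) then show ?case using split[OF N_mono[of k]] by simp
  qed (simp add: N_def)
  have "summable (\<lambda>k. \<Sum>i=N k..<N (Suc k). z i)"
    using summable_rabs_cancel[OF blocks] by (simp add: N_def)
  then have "(\<lambda>k. s (N k)) \<longlonglongrightarrow> s 1 + (\<Sum>k. \<Sum>i=N k..<N (Suc k). z i)"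
    unfolding sN by (intro tendsto_add tendsto_const summable_LIMSEQ)
  then obtain L where L: "(\<lambda>k. s (N k)) \<longlonglongrightarrow> L" by blast
  have near: "\<bar>s n - s (N k)\<bar> \<le> 7 * C / real (Suc k)" if n: "N k \<le> n" "n < N (Suc k)" for n k
  proof -
    have "\<bar>s n - s (N k)\<bar> \<le> (\<Sum>i=N k..<n. \<bar>z i\<bar>)"
      using split[OF n(1)] by (simp add: sum_abs)
    also have "\<dots> \<le> (\<Sum>i=N k..<n. C / real (N k))"
    proof (intro sum_mono)
      fix i assume "i \<in> {N k..<n}"
      then have "N k \<le> Suc i" by simp
      then have "real (N k) \<le> real (Suc i)" by (rule of_nat_mono)
      moreover have "real (N k) > 0" by (simp add: N_def)
      ultimately show "\<bar>z i\<bar> \<le> C / real (N k)"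
        using bound[of i] C0 frac_le[of C C "real (N k)" "real (Suc i)"] by linarith
    qed
    also have "\<dots> = real (n - N k) * (C / real (N k))" by simp
    also have "\<dots> \<le> (7 * real (Suc k)^2) * (C / real (N k))"
    proof (intro mult_right_mono)
      have "real (n - N k) \<le> real (N (Suc k)) - real (N k)"
        using n by linarith
      \<comment> \<open>With m = k + 1 the difference of the cubes is 3 m^2 + 3 m + 1, and m is at
        least 1.\<close>
      also have "\<dots> \<le> 7 * real (Suc k)^2"
        by (simp add: N_def power2_eq_square power3_eq_cube algebra_simps)
      finally show "real (n - N k) \<le> 7 * real (Suc k)^2" .
    qed (use C0 in auto)
    also have "\<dots> = 7 * C / real (Suc k)"
    proof -
      have "(7 * r^2) * (C / r^3) = 7 * C / r" if "r > 0" for r :: real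
        using that by (simp add: power2_eq_square power3_eq_cube)
      then show ?thesis by (simp add: N_def del: of_nat_Suc)
    qed
    finally show ?thesis .
  qed
  have "s \<longlonglongrightarrow> L"
  proof (rule LIMSEQ_I)
    fix e :: real assume e: "e > 0"
    obtain K1 where K1: "\<And>k. k \<ge> K1 \<Longrightarrow> \<bar>s (N k) - L\<bar> < e / 2"
      using LIMSEQ_D[OF L, of "e / 2"] e by auto
    \<comment> \<open>The constant 14 = 2 * 7 makes the fluctuation inside a block smaller than e /
      2.\<close>
    obtain K2 where K2: "real K2 > 14 * C / e"
      using reals_Archimedean2 by blast
    define K where "K = max K1 K2"
    have "\<bar>s n - L\<bar> < e" if n: "n \<ge> N K" for n
    proof -
      \<comment> \<open>The blocks from \<open>K\<close> on cover all indices from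
        \<open>N K\<close> on: moving from \<open>m\<close> to \<open>Suc m\<close> either stays in
        the block or enters the next one.\<close>
      have "\<exists>k\<ge>K. N k \<le> n \<and> n < N (Suc k)"
        using n
      proof (induction n rule: dec_induct)
        case base
        have "N K < N (Suc K)" unfolding N_def by (intro power_strict_mono) auto
        then show ?case by auto
      next
        case (step m)
        then obtain k where k: "k \<ge> K" "N k \<le> m" "m < N (Suc k)" by auto
        have "N (Suc k) < N (Suc (Suc k))" unfolding N_def by (intro power_strict_mono) auto
        show ?case
        proof (cases "Suc m < N (Suc k)")
          case True then show ?thesis using k by (intro exI[of _ k]) auto
        next
          case False then show ?thesis
            using k \<open>N (Suc k) < N (Suc (Suc k))\<close> by (intro exI[of _ "Suc k"]) auto
        qed
      qed
      then obtain k where k: "k \<ge> K" "N k \<le> n" "n < N (Suc k)" by blast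
      have "14 * C / e < real (Suc k)" using K2 k(1) by (auto simp: K_def)
      then have "7 * C / real (Suc k) < e / 2" using e by (simp add: field_simps)
      moreover have "\<bar>s (N k) - L\<bar> < e / 2" using K1 k(1) by (auto simp: K_def)
      ultimately show ?thesis using near[OF k(2,3)] by linarith
    qed
    then show "\<exists>no. \<forall>n\<ge>no. norm (s n - L) < e" by auto
  qed
  then show ?thesis unfolding s_def convergent_def by blast
qed

subsection \<open>Almost sure convergence of orthogonal series\<close>

text \<open>A block between consecutive cubes has second moment \<open>O(k\<^sup>-\<^sup>4)\<close>, so block sums are absolutely
  summable almost surely, while fluctuations inside a block are deterministically \<open>O(k\<^sup>-\<^sup>1)\<close>. This
  makes a maximal inequality unnecessary.\<close>

lemma (in prob_space) AE_convergent_sum_orthogonal: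
  fixes z :: "nat \<Rightarrow> 'a \<Rightarrow> real"
  assumes meas [measurable]: "\<And>i. z i \<in> borel_measurable M"
    and bound: "\<And>i \<omega>. \<omega> \<in> space M \<Longrightarrow> \<bar>z i \<omega>\<bar> \<le> C / real (Suc i)"
    and orth: "\<And>i j. i < j \<Longrightarrow> expectation (\<lambda>\<omega>. z i \<omega> * z j \<omega>) = 0"
  shows "AE \<omega> in M. convergent (\<lambda>n. \<Sum>i<n. z i \<omega>)"
proof -
  define J :: "nat \<Rightarrow> nat set" where "J k = {(Suc k)^3..<(Suc (Suc k))^3}" for k
  define B where "B k \<omega> = (\<Sum>i\<in>J k. z i \<omega>)" for k \<omega>
  have [measurable]: "B k \<in> borel_measurable M" for k unfolding B_def by measurable
  obtain \<omega>0 where "\<omega>0 \<in> space M" using not_empty by blast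
  then have C0: "C \<ge> 0" using bound[of \<omega>0 0] by simp
  have zC: "\<bar>z i \<omega>\<bar> \<le> C" if "\<omega> \<in> space M" for i \<omega>
  proof -
    have "C / real (Suc i) \<le> C / 1" using C0 by (intro divide_left_mono) auto
    then show ?thesis using bound[OF that, of i] by simp
  qed
  have int_zz: "integrable M (\<lambda>\<omega>. z i \<omega> * z j \<omega>)" for i j
  proof (rule integrable_const_bound[of _ "C * C"])
    show "AE \<omega> in M. norm (z i \<omega> * z j \<omega>) \<le> C * C"
      using zC C0 by (auto intro!: AE_I2 mult_mono simp: abs_mult)
  qed auto
  have int_B2: "integrable M (\<lambda>\<omega>. (B k \<omega>)\<^sup>2)" for k
    unfolding B_def power2_eq_square sum_product by (intro Bochner_Integration.integrable_sum int_zz)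
  have B2: "expectation (\<lambda>\<omega>. (B k \<omega>)\<^sup>2) \<le> 7 * C\<^sup>2 / real (Suc k)^4" for k
  proof -
    \<comment> \<open>Orthogonality removes the off-diagonal terms, so the second moment of a block
      is the sum of the second moments of its terms.\<close>
    have diag: "(\<Sum>j\<in>J k. expectation (\<lambda>\<omega>. z i \<omega> * z j \<omega>)) = expectation (\<lambda>\<omega>. z i \<omega> * z i \<omega>)"
      if "i \<in> J k" for i
    proof -
      have "expectation (\<lambda>\<omega>. z i \<omega> * z j \<omega>) = 0" if "j \<noteq> i" for j
        using that orth[of i j] orth[of j i] by (cases "i < j") (auto simp: mult.commute)
      then have "(\<Sum>j\<in>J k. expectation (\<lambda>\<omega>. z i \<omega> * z j \<omega>))
        = (\<Sum>j\<in>J k. if j = i then expectation (\<lambda>\<omega>. z i \<omega> * z i \<omega>) else 0)"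
        by (intro sum.cong) auto
      then show ?thesis using that by (simp add: J_def)
    qed
    have "expectation (\<lambda>\<omega>. (B k \<omega>)\<^sup>2) = (\<Sum>i\<in>J k. \<Sum>j\<in>J k. expectation (\<lambda>\<omega>. z i \<omega> * z j \<omega>))"
      unfolding B_def power2_eq_square sum_product
      by (simp add: int_zz)
    also have "\<dots> = (\<Sum>i\<in>J k. expectation (\<lambda>\<omega>. z i \<omega> * z i \<omega>))"
      by (intro sum.cong diag) auto
    also have "\<dots> \<le> (\<Sum>i\<in>J k. (C / real (Suc k)^3)\<^sup>2)"
    proof (intro sum_mono)
      fix i assume "i \<in> J k"
      then have "Suc k ^ 3 \<le> Suc i" by (auto simp: J_def)
      then have ge: "real (Suc k)^3 \<le> real (Suc i)" by (metis of_nat_le_iff of_nat_power)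
      have "\<bar>z i \<omega>\<bar> \<le> C / real (Suc k)^3" if "\<omega> \<in> space M" for \<omega>
      proof -
        have "C / real (Suc i) \<le> C / real (Suc k)^3"
          using ge C0 by (intro divide_left_mono) auto
        then show ?thesis using bound[OF that, of i] by linarith
      qed
      then have "z i \<omega> * z i \<omega> \<le> (C / real (Suc k)^3)\<^sup>2" if "\<omega> \<in> space M" for \<omega>
        using that abs_le_square_iff[of "z i \<omega>" "C / real (Suc k)^3"] C0
        by (simp add: power2_eq_square)
      then show "expectation (\<lambda>\<omega>. z i \<omega> * z i \<omega>) \<le> (C / real (Suc k)^3)\<^sup>2"
        by (intro integral_le_const int_zz AE_I2)
    qed
    also have "\<dots> = real (card (J k)) * (C / real (Suc k)^3)\<^sup>2" by simp
    also have "\<dots> \<le> (7 * real (Suc k)^2) * (C / real (Suc k)^3)\<^sup>2"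
    proof (intro mult_right_mono)
      have "Suc k ^ 3 \<le> Suc (Suc k) ^ 3" by (intro power_mono) auto
      then have "real (card (J k)) = real (Suc (Suc k))^3 - real (Suc k)^3"
        unfolding J_def by (metis card_atLeastLessThan of_nat_diff of_nat_power)
      also have "\<dots> \<le> 7 * real (Suc k)^2"
        by (simp add: power2_eq_square power3_eq_cube algebra_simps)
      finally show "real (card (J k)) \<le> 7 * real (Suc k)^2" .
    qed auto
    also have "\<dots> = 7 * C\<^sup>2 / real (Suc k)^4"
      by (simp add: power_divide power_mult[symmetric] divide_simps del: of_nat_Suc flip: power_add)
    finally show ?thesis .
  qed
  \<comment> \<open>By the inequality of arithmetic and geometric means, |B k| is at most
    \<open>g k\<close>. The second moment of \<open>B k\<close> is of order (k + 1)^-4, so the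
    choice e k = (k + 1)^-2 balances the two summands of \<open>g k\<close> and makes the
    expectations of \<open>g k\<close> summable.\<close>
  define e where "e k = 1 / real (Suc k)^2" for k
  have e0: "e k > 0" for k by (simp add: e_def)
  define g where "g k \<omega> = (e k + (B k \<omega>)\<^sup>2 / e k) / 2" for k \<omega>
  have g0: "g k \<omega> \<ge> 0" for k \<omega> using e0[of k] by (simp add: g_def)
  have [measurable]: "g k \<in> borel_measurable M" for k unfolding g_def by measurable
  have int_g: "integrable M (g k)" for k
    unfolding g_def using int_B2[of k] by auto
  have Eg: "expectation (g k) \<le> (1 + 7 * C\<^sup>2) / 2 * e k" for k
  proof -
    have "expectation (g k) = (e k + expectation (\<lambda>\<omega>. (B k \<omega>)\<^sup>2) / e k) / 2"
      unfolding g_def using int_B2[of k] by (simp add: prob_space)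
    also have "\<dots> \<le> (e k + (7 * C\<^sup>2 / real (Suc k)^4) / e k) / 2"
      using B2[of k] e0[of k] by (intro divide_right_mono add_left_mono) auto
    also have "(7 * C\<^sup>2 / real (Suc k)^4) / e k = 7 * C\<^sup>2 * e k"
      by (simp add: e_def divide_simps del: of_nat_Suc flip: power_add)
    finally show ?thesis by (simp add: algebra_simps)
  qed
  have sum_e: "summable e"
    using inverse_power_summable[of 2, where 'a = real]
    unfolding e_def by (subst summable_Suc_iff[of "\<lambda>k. 1 / real k ^ 2"]) (simp add: inverse_eq_divide)
  have sum_Eg: "summable (\<lambda>k. expectation (g k))"
  proof (rule summable_comparison_test'[OF summable_mult[OF sum_e], of 0])
    show "norm (expectation (g k)) \<le> (1 + 7 * C\<^sup>2) / 2 * e k" for k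
      using Eg[of k] Bochner_Integration.integral_nonneg[of M "g k"] g0[of k] by simp
  qed
  \<comment> \<open>Monotone convergence: the sum of the \<open>g k\<close> has finite expectation
    and is therefore finite almost surely.\<close>
  have "(\<integral>\<^sup>+\<omega>. (\<Sum>k. ennreal (g k \<omega>)) \<partial>M) = (\<Sum>k. \<integral>\<^sup>+\<omega>. ennreal (g k \<omega>) \<partial>M)"
    by (rule nn_integral_suminf) auto
  also have "\<dots> = (\<Sum>k. ennreal (expectation (g k)))"
    using int_g g0 by (simp add: nn_integral_eq_integral)
  also have "\<dots> = ennreal (\<Sum>k. expectation (g k))"
    using g0 by (intro suminf_ennreal2 sum_Eg Bochner_Integration.integral_nonneg) auto
  finally have "AE \<omega> in M. (\<Sum>k. ennreal (g k \<omega>)) \<noteq> \<infinity>"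
    by (intro nn_integral_PInf_AE) auto
  then show ?thesis
  proof (rule AE_mp, intro AE_I2 impI)
    fix \<omega> assume \<omega>: "\<omega> \<in> space M" and fin: "(\<Sum>k. ennreal (g k \<omega>)) \<noteq> \<infinity>"
    have "summable (\<lambda>k. g k \<omega>)" using fin g0 by (intro summable_suminf_not_top) auto
    moreover have "\<bar>B k \<omega>\<bar> \<le> g k \<omega>" for k
    proof -
      have "0 \<le> (e k - \<bar>B k \<omega>\<bar>)\<^sup>2" by simp
      then have "2 * \<bar>B k \<omega>\<bar> * e k \<le> e k * e k + (B k \<omega>)\<^sup>2"
        by (simp add: power2_eq_square algebra_simps)
      then show ?thesis using e0[of k] by (simp add: g_def field_simps)
    qed
    ultimately have "summable (\<lambda>k. \<bar>B k \<omega>\<bar>)"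
      by (intro summable_comparison_test'[of "\<lambda>k. g k \<omega>" 0 "\<lambda>k. \<bar>B k \<omega>\<bar>"]) simp_all
    then show "convergent (\<lambda>n. \<Sum>i<n. z i \<omega>)"
      unfolding B_def J_def by (rule convergent_of_cube_blocks[OF bound[OF \<omega>]])
  qed
qed

subsection \<open>Urns with predictable bounded reinforcement\<close>

text \<open>Draw \<open>n\<close> takes place between the times n and n + 1: its reinforcement
  \<open>W n\<close> is known at time n, its outcome \<open>D n\<close> at time n + 1. The initial
  weights are \<open>a\<close> for left and \<open>b\<close> in total. The lower bound 1 on the
  reinforcements makes the total weight grow at least linearly; together with the upper bound
  \<open>C\<close> it limits the effect of draw n on the proportion to order 1 / n.\<close>

locale weighted_urn = prob_space M
  for M :: "'a measure" +
  fixes F :: "nat \<Rightarrow> 'a measure" and W D :: "nat \<Rightarrow> 'a \<Rightarrow> real" and a b C :: real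
  assumes subalg: "\<And>n. subalgebra M (F n)"
    and filtration: "\<And>n. sets (F n) \<subseteq> sets (F (Suc n))"
    and W_measurable [measurable]: "\<And>n. W n \<in> borel_measurable (F n)"
    and D_adapted: "\<And>n. D n \<in> borel_measurable (F (Suc n))"
    and D_values: "\<And>n \<omega>. \<omega> \<in> space M \<Longrightarrow> D n \<omega> \<in> {0, 1}"
    and W_ge: "\<And>n \<omega>. \<omega> \<in> space M \<Longrightarrow> 1 \<le> W n \<omega>"
    and W_le: "\<And>n \<omega>. \<omega> \<in> space M \<Longrightarrow> W n \<omega> \<le> C"
    and a_pos: "0 < a" and a_less: "a < b"
    and draw: "\<And>n. AE \<omega> in M. real_cond_exp M (F n) (D n) \<omega> =
                 (a + (\<Sum>i<n. W i \<omega> * D i \<omega>)) / (b + (\<Sum>i<n. W i \<omega>))"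
begin

section \<open>Weights, proportions and their bounds\<close>

definition X :: "nat \<Rightarrow> 'a \<Rightarrow> real" where
  "X n \<omega> = a + (\<Sum>i<n. W i \<omega> * D i \<omega>)"

definition Y :: "nat \<Rightarrow> 'a \<Rightarrow> real" where
  "Y n \<omega> = b + (\<Sum>i<n. W i \<omega>)"

definition P :: "nat \<Rightarrow> 'a \<Rightarrow> real" where
  "P n \<omega> = X n \<omega> / Y n \<omega>"

lemma space_F: "space (F n) = space M"
  using subalg[of n] by (simp add: subalgebra_def)

lemma measurable_F_mono:
  assumes "m \<le> n" "f \<in> borel_measurable (F m)"
  shows "f \<in> borel_measurable (F n)"
proof -
  have "sets (F m) \<subseteq> sets (F n)"
    using lift_Suc_mono_le[of "\<lambda>n. sets (F n)", OF filtration assms(1)] .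
  then have "subalgebra (F n) (F m)" by (simp add: subalgebra_def space_F)
  then show ?thesis using assms(2) by (rule measurable_from_subalg)
qed

lemma measurable_F_M:
  "f \<in> borel_measurable (F n) \<Longrightarrow> f \<in> borel_measurable M"
  using measurable_from_subalg[OF subalg] .

lemma D_borel [measurable]: "D n \<in> borel_measurable M"
  using measurable_F_M[OF D_adapted] .

lemma X_measurable [measurable]: "X n \<in> borel_measurable (F n)"
proof -
  have "(\<lambda>\<omega>. W i \<omega> * D i \<omega>) \<in> borel_measurable (F n)" if "i < n" for i
    using that
    by (intro borel_measurable_times measurable_F_mono[OF _ W_measurable, of i n]
        measurable_F_mono[OF _ D_adapted, of i n]) auto
  then show ?thesis unfolding X_def by measurable
qed

lemma Y_measurable [measurable]: "Y n \<in> borel_measurable (F n)"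
proof -
  have "W i \<in> borel_measurable (F n)" if "i < n" for i
    using that measurable_F_mono[OF _ W_measurable, of i n] by simp
  then show ?thesis unfolding Y_def by measurable
qed

lemma P_measurable [measurable]: "P n \<in> borel_measurable (F n)"
  unfolding P_def by measurable

lemma P_borel [measurable]: "P n \<in> borel_measurable M"
  using measurable_F_M[OF P_measurable] .

lemma X_ge:
  assumes "\<omega> \<in> space M"
  shows "a \<le> X n \<omega>"
proof -
  have "0 \<le> W i \<omega> * D i \<omega>" for i
    using D_values[OF assms, of i] W_ge[OF assms, of i] by auto
  then show ?thesis unfolding X_def by (simp add: sum_nonneg)
qed

lemma X_less_Y:
  assumes "\<omega> \<in> space M"
  shows "X n \<omega> < Y n \<omega>"
proof -
  have "W i \<omega> * D i \<omega> \<le> W i \<omega>" for i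
    using D_values[OF assms, of i] W_ge[OF assms, of i] by auto
  then show ?thesis
    unfolding X_def Y_def using a_less by (intro add_less_le_mono sum_mono) auto
qed

lemma Y_ge:
  assumes "\<omega> \<in> space M"
  shows "real n \<le> Y n \<omega>"
proof -
  have "(\<Sum>i<n. 1) \<le> (\<Sum>i<n. W i \<omega>)"
    by (intro sum_mono W_ge assms)
  then show ?thesis unfolding Y_def using a_pos a_less by simp
qed

lemma Y_le:
  assumes "\<omega> \<in> space M"
  shows "Y n \<omega> \<le> b + real n * C"
proof -
  have "(\<Sum>i<n. W i \<omega>) \<le> (\<Sum>i<n. C)"
    by (intro sum_mono W_le assms)
  then show ?thesis unfolding Y_def by simp
qed

lemma C_ge_1: "1 \<le> C"
proof -
  obtain \<omega> where "\<omega> \<in> space M" using not_empty by blast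
  then show ?thesis using W_ge[of \<omega> 0] W_le[of \<omega> 0] by linarith
qed

lemma X_pos: "\<omega> \<in> space M \<Longrightarrow> 0 < X n \<omega>"
  using X_ge[of \<omega> n] a_pos by linarith

lemma Y_pos: "\<omega> \<in> space M \<Longrightarrow> 0 < Y n \<omega>"
  using X_pos[of \<omega> n] X_less_Y[of \<omega> n] by linarith

lemma P_pos: "\<omega> \<in> space M \<Longrightarrow> 0 < P n \<omega>"
  by (simp add: P_def X_pos Y_pos)

lemma P_less_1: "\<omega> \<in> space M \<Longrightarrow> P n \<omega> < 1"
  using X_less_Y[of \<omega> n] Y_pos[of \<omega> n] by (simp add: P_def)

text \<open>The bounded factor \<open>G\<close> is known before draw \<open>n\<close> and can be
  pulled out of the conditional expectation, which for the draw is \<open>P n\<close>. All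
  expectation computations below use the law of the draws through this identity.\<close>

lemma expectation_mult_D:
  assumes [measurable]: "G \<in> borel_measurable (F n)"
    and bound: "\<And>\<omega>. \<omega> \<in> space M \<Longrightarrow> \<bar>G \<omega>\<bar> \<le> K"
  shows "expectation (\<lambda>\<omega>. G \<omega> * D n \<omega>) = expectation (\<lambda>\<omega>. G \<omega> * P n \<omega>)"
proof -
  interpret finite_measure_subalgebra M "F n"
    by unfold_locales (rule subalg)
  have [measurable]: "G \<in> borel_measurable M"
    using measurable_F_M[OF assms(1)] .
  have "integrable M (\<lambda>\<omega>. G \<omega> * D n \<omega>)"
  proof (rule integrable_const_bound[of _ K])
    show "AE \<omega> in M. norm (G \<omega> * D n \<omega>) \<le> K"
    proof (intro AE_I2)
      fix \<omega> assume "\<omega> \<in> space M"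
      then show "norm (G \<omega> * D n \<omega>) \<le> K"
        using bound[of \<omega>] D_values[of \<omega> n] by auto
    qed
  qed measurable
  then have "expectation (\<lambda>\<omega>. G \<omega> * D n \<omega>) = expectation (\<lambda>\<omega>. G \<omega> * real_cond_exp M (F n) (D n) \<omega>)"
    by (intro real_cond_exp_intg(2)[symmetric]) auto
  also have "\<dots> = expectation (\<lambda>\<omega>. G \<omega> * P n \<omega>)"
  proof (rule integral_cong_AE)
    show "AE \<omega> in M. G \<omega> * real_cond_exp M (F n) (D n) \<omega> = G \<omega> * P n \<omega>"
      using draw[of n] by eventually_elim (simp add: P_def X_def Y_def)
  qed measurable
  finally show ?thesis .
qed

section \<open>Martingale transforms of the centred draws\<close>

lemma abs_D_minus_P_le:
  "\<omega> \<in> space M \<Longrightarrow> \<bar>D n \<omega> - P n \<omega>\<bar> \<le> 1"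
  using D_values[of \<omega> n] P_pos[of \<omega> n] P_less_1[of \<omega> n] by auto

text \<open>A centred draw with a predictable weight is a martingale difference, so distinct terms
  are orthogonal. The bound on the weights is the one that the theorem on orthogonal series
  requires.\<close>

lemma AE_convergent_martingale_transform:
  assumes H [measurable]: "\<And>n. H n \<in> borel_measurable (F n)"
    and bound: "\<And>n \<omega>. \<omega> \<in> space M \<Longrightarrow> \<bar>H n \<omega>\<bar> \<le> K / real (Suc n)"
  shows "AE \<omega> in M. convergent (\<lambda>n. \<Sum>i<n. H i \<omega> * (D i \<omega> - P i \<omega>))"
proof (rule AE_convergent_sum_orthogonal[of _ K])
  have [measurable]: "H n \<in> borel_measurable M" for n
    using measurable_F_M[OF H] .
  show "(\<lambda>\<omega>. H i \<omega> * (D i \<omega> - P i \<omega>)) \<in> borel_measurable M" for i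
    by measurable
  show z_le: "\<bar>H i \<omega> * (D i \<omega> - P i \<omega>)\<bar> \<le> K / real (Suc i)" if "\<omega> \<in> space M" for i \<omega>
    using mult_mono[OF bound[OF that, of i] abs_D_minus_P_le[OF that, of i]] bound[OF that, of i]
    by (simp add: abs_mult)
  obtain \<omega>0 where \<omega>0: "\<omega>0 \<in> space M" using not_empty by blast
  then have K0: "K \<ge> 0" using bound[of \<omega>0 0] by simp
  have H_le: "\<bar>H i \<omega>\<bar> \<le> K" if "\<omega> \<in> space M" for i \<omega>
    using bound[OF that, of i] K0 divide_left_mono[of 1 "real (Suc i)" K] by simp
  show "expectation (\<lambda>\<omega>. H i \<omega> * (D i \<omega> - P i \<omega>) * (H j \<omega> * (D j \<omega> - P j \<omega>))) = 0"
    if "i < j" for i j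
  proof -
    \<comment> \<open>For i < j, \<open>G\<close> collects every factor of the product that is known
      before draw \<open>j\<close>.\<close>
    define G where "G \<omega> = H i \<omega> * (D i \<omega> - P i \<omega>) * H j \<omega>" for \<omega>
    have G: "G \<in> borel_measurable (F j)"
      unfolding G_def using that
      by (intro borel_measurable_times borel_measurable_diff H measurable_F_mono[OF _ H, of i j]
          measurable_F_mono[OF _ P_measurable, of i j] measurable_F_mono[OF _ D_adapted, of i j]) auto
    have G_le: "\<bar>G \<omega>\<bar> \<le> K * 1 * K" if \<omega>: "\<omega> \<in> space M" for \<omega>
      unfolding G_def abs_mult
      by (intro mult_mono H_le abs_D_minus_P_le \<omega> mult_nonneg_nonneg abs_ge_zero K0 zero_le_one)
    note [measurable] = measurable_F_M[OF G]
    have "\<bar>D j \<omega>\<bar> \<le> 1" "\<bar>P j \<omega>\<bar> \<le> 1" if "\<omega> \<in> space M" for \<omega>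
      using D_values[OF that, of j] P_pos[OF that, of j] P_less_1[OF that, of j] by auto
    then have "\<bar>G \<omega> * D j \<omega>\<bar> \<le> K * 1 * K * 1" "\<bar>G \<omega> * P j \<omega>\<bar> \<le> K * 1 * K * 1"
      if "\<omega> \<in> space M" for \<omega>
      unfolding abs_mult
      by (intro mult_mono[OF G_le] that mult_nonneg_nonneg abs_ge_zero K0 zero_le_one; simp add: that)+
    then have int: "integrable M (\<lambda>\<omega>. G \<omega> * D j \<omega>)" "integrable M (\<lambda>\<omega>. G \<omega> * P j \<omega>)"
      by (intro integrable_const_bound[of _ "K * 1 * K * 1"] AE_I2; simp)+
    have "expectation (\<lambda>\<omega>. H i \<omega> * (D i \<omega> - P i \<omega>) * (H j \<omega> * (D j \<omega> - P j \<omega>)))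
        = expectation (\<lambda>\<omega>. G \<omega> * D j \<omega> - G \<omega> * P j \<omega>)"
      by (intro Bochner_Integration.integral_cong) (auto simp: G_def algebra_simps)
    also have "\<dots> = 0"
      using int expectation_mult_D[OF G G_le] by simp
    finally show ?thesis .
  qed
qed

text \<open>A martingale law of large numbers: bounded weights divided by n + 1 give a convergent
  series, and Kronecker's lemma turns this into averages.\<close>

lemma AE_mean_transform_tendsto_0:
  assumes [measurable]: "\<And>n. H n \<in> borel_measurable (F n)"
    and bound: "\<And>n \<omega>. \<omega> \<in> space M \<Longrightarrow> \<bar>H n \<omega>\<bar> \<le> K"
  shows "AE \<omega> in M. (\<lambda>n. (\<Sum>i<n. H i \<omega> * (D i \<omega> - P i \<omega>)) / real n) \<longlonglongrightarrow> 0"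
proof -
  have "AE \<omega> in M. convergent (\<lambda>n. \<Sum>i<n. (H i \<omega> / real (Suc i)) * (D i \<omega> - P i \<omega>))"
    by (rule AE_convergent_martingale_transform[of _ K])
      (use bound in \<open>auto simp: divide_right_mono\<close>)
  then show ?thesis
    by eventually_elim (intro kronecker_mean_tendsto_0, simp)
qed

section \<open>Almost sure convergence of the proportion\<close>

lemma X_Suc: "X (Suc n) \<omega> = X n \<omega> + W n \<omega> * D n \<omega>"
  and Y_Suc: "Y (Suc n) \<omega> = Y n \<omega> + W n \<omega>"
  by (simp_all add: X_def Y_def)

text \<open>One draw moves the proportion by W / (Y + W) times the centred draw, so
  \<open>P n\<close> is \<open>P 0\<close> plus a martingale transform. Its weights are at most C /
  (n + 1) because Y n + W n is at least n + 1.\<close>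

lemma AE_convergent_P: "AE \<omega> in M. convergent (\<lambda>n. P n \<omega>)"
proof -
  have "AE \<omega> in M. convergent (\<lambda>n. \<Sum>i<n. (W i \<omega> / (Y i \<omega> + W i \<omega>)) * (D i \<omega> - P i \<omega>))"
  proof (rule AE_convergent_martingale_transform[of _ C])
    fix n \<omega> assume \<omega>: "\<omega> \<in> space M"
    have "real (Suc n) \<le> Y n \<omega> + W n \<omega>"
      using Y_ge[OF \<omega>, of n] W_ge[OF \<omega>, of n] by simp
    then show "\<bar>W n \<omega> / (Y n \<omega> + W n \<omega>)\<bar> \<le> C / real (Suc n)"
      using W_ge[OF \<omega>, of n] W_le[OF \<omega>, of n] by (auto intro!: frac_le)
  qed measurable
  then show ?thesis
  proof (rule AE_mp, intro AE_I2 impI)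
    fix \<omega> assume \<omega>: "\<omega> \<in> space M"
      and conv: "convergent (\<lambda>n. \<Sum>i<n. (W i \<omega> / (Y i \<omega> + W i \<omega>)) * (D i \<omega> - P i \<omega>))"
    have step: "P (Suc n) \<omega> = P n \<omega> + (W n \<omega> / (Y n \<omega> + W n \<omega>)) * (D n \<omega> - P n \<omega>)" for n
      using Y_pos[OF \<omega>, of n] W_ge[OF \<omega>, of n]
      by (simp add: P_def X_Suc Y_Suc divide_simps add_pos_pos) (simp add: algebra_simps)
    have "P n \<omega> = P 0 \<omega> + (\<Sum>i<n. (W i \<omega> / (Y i \<omega> + W i \<omega>)) * (D i \<omega> - P i \<omega>))" for n
      by (induction n) (simp_all add: step)
    then have eq: "(\<lambda>n. P n \<omega>) =
        (\<lambda>n. P 0 \<omega> + (\<Sum>i<n. (W i \<omega> / (Y i \<omega> + W i \<omega>)) * (D i \<omega> - P i \<omega>)))"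
      by (rule ext)
    show "convergent (\<lambda>n. P n \<omega>)"
      by (subst eq) (rule convergent_add[OF convergent_const conv])
  qed
qed

section \<open>A supermartingale excluding the limit 0\<close>

text \<open>The logarithmic term alone has drift up to \<open>w\<^sup>2 / (y (x + w))\<close>, which the drift
  \<open>- C w / (y (x + w))\<close> of the correction \<open>C / x\<close> absorbs.\<close>

definition \<Phi> :: "real \<Rightarrow> real \<Rightarrow> real" where
  "\<Phi> x y = C / x - ln (x / y)"

text \<open>The left-hand side is the mean of \<open>\<Phi>\<close> after a draw with reinforcement
  \<open>w\<close> that is left with probability x / y. The inequality is therefore the one-step
  supermartingale property.\<close>

lemma \<Phi>_drift:
  assumes x: "0 < x" and y: "0 < y" and w: "0 \<le> w" "w \<le> C"
  shows "\<Phi> x (y + w) + (\<Phi> (x + w) (y + w) - \<Phi> x (y + w)) * (x / y) \<le> \<Phi> x y"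
proof -
  define t where "t = ln (x + w) - ln x"
  \<comment> \<open>The bound ln z <= z - 1 is used twice: here it bounds the growth of ln x from
    below, and at (y + w) / y it bounds the growth of ln y from above.\<close>
  have "ln (x / (x + w)) \<le> x / (x + w) - 1"
    using x w by (intro ln_le_minus_one) simp
  then have t: "w / (x + w) \<le> t"
    using x w by (simp add: t_def ln_div field_simps)
  have "ln ((y + w) / y) \<le> (y + w) / y - 1"
    using y w by (intro ln_le_minus_one) simp
  then have s: "ln (y + w) - ln y \<le> w / y"
    using y w by (simp add: ln_div field_simps)
  have "w / y - w / (x + w) * (x / y) - (C / x - C / (x + w)) * (x / y) = w * (w - C) / (y * (x + w))"
    using x y w by (simp add: divide_simps add_pos_nonneg) (simp add: algebra_simps)
  \<comment> \<open>The sign comes from \<open>w \<le> C\<close>, which is why the coefficient of 1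
    / x in \<open>\<Phi>\<close> is the bound on the reinforcements.\<close>
  also have "\<dots> \<le> 0"
    using x y w by (intro divide_nonpos_pos mult_nonneg_nonpos mult_pos_pos) auto
  finally have c: "w / y - w / (x + w) * (x / y) - (C / x - C / (x + w)) * (x / y) \<le> 0" .
  have "w / (x + w) * (x / y) \<le> t * (x / y)"
    using t x y by (intro mult_right_mono) auto
  moreover have "\<Phi> x (y + w) + (\<Phi> (x + w) (y + w) - \<Phi> x (y + w)) * (x / y) - \<Phi> x y
      = (ln (y + w) - ln y) - t * (x / y) - (C / x - C / (x + w)) * (x / y)"
    using x y w by (simp add: \<Phi>_def t_def ln_div algebra_simps)
  ultimately show ?thesis using s c by linarith
qed

text \<open>Nonnegativity is what Fatou's lemma needs. The upper bound grows with \<open>R\<close>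
  and serves only for integrability at a fixed time.\<close>

lemma \<Phi>_bounds:
  assumes "a \<le> x" "x \<le> y" "y \<le> R"
  shows "0 \<le> \<Phi> x y" "\<Phi> x y \<le> C / a + ln R - ln a"
proof -
  have pos: "0 < x" "0 < y" "0 < R" using assms a_pos by auto
  have "0 \<le> C / x" "C / x \<le> C / a" using pos assms C_ge_1 a_pos by (auto intro: divide_left_mono)
  moreover have "ln (x / y) = ln x - ln y" "ln a \<le> ln x" "ln x \<le> ln y" "ln y \<le> ln R"
    using assms pos a_pos by (auto simp: ln_div)
  ultimately show "0 \<le> \<Phi> x y" "\<Phi> x y \<le> C / a + ln R - ln a"
    by (auto simp: \<Phi>_def)
qed

lemma \<Phi>_XY_nonneg: "\<omega> \<in> space M \<Longrightarrow> 0 \<le> \<Phi> (X n \<omega>) (Y n \<omega>)"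
  using X_ge X_less_Y by (intro \<Phi>_bounds(1)[of _ _ "Y n \<omega>"]) (auto intro: less_imp_le)

text \<open>The next value is \<open>u\<close> after a left draw and \<open>v\<close> after a right
  draw, both known beforehand. Replacing \<open>D n\<close> by \<open>P n\<close> in the expectation
  leaves the pointwise inequality \<open>\<Phi>_drift\<close>.\<close>

lemma expectation_\<Phi>_Suc_le:
  "integrable M (\<lambda>\<omega>. \<Phi> (X n \<omega>) (Y n \<omega>))"
  "expectation (\<lambda>\<omega>. \<Phi> (X (Suc n) \<omega>) (Y (Suc n) \<omega>)) \<le> expectation (\<lambda>\<omega>. \<Phi> (X n \<omega>) (Y n \<omega>))"
proof -
  \<comment> \<open>\<open>R\<close> bounds the total weight after draw \<open>n\<close>: Y n is at
    most b + n C and the reinforcement adds at most \<open>C\<close>.\<close>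
  define R where "R = b + real n * C + C"
  define K where "K = C / a + ln R - ln a"
  define u where "u \<omega> = \<Phi> (X n \<omega> + W n \<omega>) (Y n \<omega> + W n \<omega>)" for \<omega>
  define v where "v \<omega> = \<Phi> (X n \<omega>) (Y n \<omega> + W n \<omega>)" for \<omega>
  define f where "f \<omega> = \<Phi> (X n \<omega>) (Y n \<omega>)" for \<omega>
  have uvf [measurable]: "u \<in> borel_measurable (F n)" "v \<in> borel_measurable (F n)" "f \<in> borel_measurable (F n)"
    unfolding u_def v_def f_def \<Phi>_def by measurable
  note [measurable] = uvf[THEN measurable_F_M]
  have bnd: "0 \<le> u \<omega>" "u \<omega> \<le> K" "0 \<le> v \<omega>" "v \<omega> \<le> K" "0 \<le> f \<omega>" "f \<omega> \<le> K"
    if \<omega>: "\<omega> \<in> space M" for \<omega>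
  proof -
    note facts = X_ge[OF \<omega>, of n] X_less_Y[OF \<omega>, of n] Y_le[OF \<omega>, of n] W_ge[OF \<omega>, of n] W_le[OF \<omega>, of n]
    show "0 \<le> u \<omega>" "u \<omega> \<le> K" "0 \<le> v \<omega>" "v \<omega> \<le> K" "0 \<le> f \<omega>" "f \<omega> \<le> K"
      unfolding u_def v_def f_def K_def
      by (rule \<Phi>_bounds[where R = R]; use facts in \<open>simp add: R_def\<close>)+
  qed
  have uv: "\<bar>u \<omega> - v \<omega>\<bar> \<le> K" "0 \<le> K" if "\<omega> \<in> space M" for \<omega>
    using bnd[OF that] by auto
  have "\<bar>D n \<omega>\<bar> \<le> 1" "\<bar>P n \<omega>\<bar> \<le> 1" if "\<omega> \<in> space M" for \<omega>
    using D_values[OF that, of n] P_pos[OF that, of n] P_less_1[OF that, of n] by auto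
  then have "\<bar>(u \<omega> - v \<omega>) * D n \<omega>\<bar> \<le> K * 1" "\<bar>(u \<omega> - v \<omega>) * P n \<omega>\<bar> \<le> K * 1"
    if "\<omega> \<in> space M" for \<omega>
    unfolding abs_mult
    by (intro mult_mono uv[OF that] abs_ge_zero; simp add: that)+
  then have int_uv: "integrable M (\<lambda>\<omega>. (u \<omega> - v \<omega>) * D n \<omega>)"
      "integrable M (\<lambda>\<omega>. (u \<omega> - v \<omega>) * P n \<omega>)"
    by (intro integrable_const_bound[of _ "K * 1"] AE_I2; simp)+
  have "integrable M v" "integrable M f"
    using bnd by (intro integrable_const_bound[of _ K] AE_I2; simp)+
  note int = int_uv this
  show "integrable M (\<lambda>\<omega>. \<Phi> (X n \<omega>) (Y n \<omega>))"
    using int(4) by (simp add: f_def[abs_def])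
  \<comment> \<open>Since \<open>D n\<close> is 0 or 1, the choice between \<open>u\<close> and
    \<open>v\<close> can be written as an affine function of the draw.\<close>
  have "\<Phi> (X (Suc n) \<omega>) (Y (Suc n) \<omega>) = v \<omega> + (u \<omega> - v \<omega>) * D n \<omega>" if "\<omega> \<in> space M" for \<omega>
    using D_values[OF that, of n] by (auto simp: X_Suc Y_Suc u_def v_def)
  then have "expectation (\<lambda>\<omega>. \<Phi> (X (Suc n) \<omega>) (Y (Suc n) \<omega>)) = expectation (\<lambda>\<omega>. v \<omega> + (u \<omega> - v \<omega>) * D n \<omega>)"
    by (intro Bochner_Integration.integral_cong) auto
  also have "\<dots> = expectation (\<lambda>\<omega>. v \<omega> + (u \<omega> - v \<omega>) * P n \<omega>)"
  proof -
    have "(\<lambda>\<omega>. u \<omega> - v \<omega>) \<in> borel_measurable (F n)" by measurable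
    from expectation_mult_D[OF this uv(1)] show ?thesis
      using int by simp
  qed
  also have "\<dots> \<le> expectation f"
  proof (intro integral_mono)
    fix \<omega> assume \<omega>: "\<omega> \<in> space M"
    show "v \<omega> + (u \<omega> - v \<omega>) * P n \<omega> \<le> f \<omega>"
      unfolding u_def v_def f_def P_def
      using X_pos[OF \<omega>, of n] Y_pos[OF \<omega>, of n] W_ge[OF \<omega>, of n] W_le[OF \<omega>, of n]
      by (intro \<Phi>_drift) auto
  qed (use int in auto)
  finally show "expectation (\<lambda>\<omega>. \<Phi> (X (Suc n) \<omega>) (Y (Suc n) \<omega>)) \<le> expectation (\<lambda>\<omega>. \<Phi> (X n \<omega>) (Y n \<omega>))"
    by (simp add: f_def[abs_def])
qed

text \<open>The expectations of \<open>\<Phi>\<close> stay below the initial one, so by Fatou's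
  lemma its lower limit is finite almost surely. If \<open>P n\<close> tended to 0, then -ln (P n),
  and with it the larger \<open>\<Phi>\<close>, would tend to infinity.\<close>

lemma AE_not_P_tendsto_0: "AE \<omega> in M. \<not> (\<lambda>n. P n \<omega>) \<longlonglongrightarrow> 0"
proof -
  define f where "f n \<omega> = \<Phi> (X n \<omega>) (Y n \<omega>)" for n \<omega>
  have int: "integrable M (f n)" for n
    using expectation_\<Phi>_Suc_le(1)[of n] by (simp add: f_def[abs_def])
  then have [measurable]: "f n \<in> borel_measurable M" for n by (rule borel_measurable_integrable)
  have Ef: "expectation (f n) \<le> expectation (f 0)" for n
  proof (induction n)
    case (Suc n)
    then show ?case using expectation_\<Phi>_Suc_le(2)[of n] unfolding f_def by linarith
  qed simp
  have "(\<integral>\<^sup>+\<omega>. liminf (\<lambda>n. ennreal (f n \<omega>)) \<partial>M) \<le> liminf (\<lambda>n. \<integral>\<^sup>+\<omega>. ennreal (f n \<omega>) \<partial>M)"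
    by (rule nn_integral_liminf) measurable
  also have "\<dots> \<le> liminf (\<lambda>n. ennreal (expectation (f 0)))"
  proof (intro Liminf_mono always_eventually allI)
    fix n
    have "(\<integral>\<^sup>+\<omega>. ennreal (f n \<omega>) \<partial>M) = ennreal (expectation (f n))"
      using int[of n] by (rule nn_integral_eq_integral) (auto simp: f_def \<Phi>_XY_nonneg)
    then show "(\<integral>\<^sup>+\<omega>. ennreal (f n \<omega>) \<partial>M) \<le> ennreal (expectation (f 0))"
      using Ef[of n] by (simp add: ennreal_leI)
  qed
  also have "\<dots> < \<infinity>"
    by (simp add: Liminf_const)
  finally have "AE \<omega> in M. liminf (\<lambda>n. ennreal (f n \<omega>)) \<noteq> \<infinity>"
    by (intro nn_integral_PInf_AE) auto
  then show ?thesis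
  proof (rule AE_mp, intro AE_I2 impI notI)
    fix \<omega> assume \<omega>: "\<omega> \<in> space M" and fin: "liminf (\<lambda>n. ennreal (f n \<omega>)) \<noteq> \<infinity>"
      and lim: "(\<lambda>n. P n \<omega>) \<longlonglongrightarrow> 0"
    have "filterlim (\<lambda>n. P n \<omega>) (at_right 0) sequentially"
      using lim P_pos[OF \<omega>] by (intro filterlim_at_withinI always_eventually) auto
    then have "filterlim (\<lambda>n. - ln (P n \<omega>)) at_top sequentially"
      using filterlim_compose[OF ln_at_0, of "\<lambda>n. P n \<omega>" sequentially]
      by (simp add: filterlim_uminus_at_bot)
    then have "filterlim (\<lambda>n. f n \<omega>) at_top sequentially"
    proof (rule filterlim_at_top_mono, intro always_eventually allI)
      fix n
      have "0 \<le> C / X n \<omega>" using X_pos[OF \<omega>, of n] C_ge_1 by simp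
      then show "- ln (P n \<omega>) \<le> f n \<omega>" unfolding f_def \<Phi>_def P_def by linarith
    qed
    then have "(\<lambda>n. ennreal (f n \<omega>)) \<longlonglongrightarrow> top"
      by (simp add: ennreal_tendsto_top_eq_at_top)
    then have "liminf (\<lambda>n. ennreal (f n \<omega>)) = top"
      by (intro lim_imp_Liminf) auto
    then show False using fin by simp
  qed
qed

text \<open>Exchanging the colours keeps the reinforcements and the total weight and replaces the
  initial left weight \<open>a\<close> by \<open>b - a\<close>, so each result on the left colour
  also holds for the right one.\<close>

lemma weighted_urn_flip: "weighted_urn M F W (\<lambda>n \<omega>. 1 - D n \<omega>) (b - a) b C"
proof unfold_locales
  show "subalgebra M (F n)" "sets (F n) \<subseteq> sets (F (Suc n))" "W n \<in> borel_measurable (F n)" for n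
    by (rule subalg filtration W_measurable)+
  show "(\<lambda>\<omega>. 1 - D n \<omega>) \<in> borel_measurable (F (Suc n))" for n
    by (intro borel_measurable_diff D_adapted) simp
  show "1 - D n \<omega> \<in> {0, 1}" if "\<omega> \<in> space M" for n \<omega>
    using D_values[OF that, of n] by auto
  show "0 < b - a" "b - a < b" using a_pos a_less by auto
  show "AE \<omega> in M. real_cond_exp M (F n) (\<lambda>\<omega>. 1 - D n \<omega>) \<omega> =
      (b - a + (\<Sum>i<n. W i \<omega> * (1 - D i \<omega>))) / (b + (\<Sum>i<n. W i \<omega>))" for n
  proof -
    interpret finite_measure_subalgebra M "F n"
      by unfold_locales (rule subalg)
    have int: "integrable M (\<lambda>_. 1 :: real)" "integrable M (D n)"
    proof -
      show "integrable M (D n)"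
      proof (rule integrable_const_bound[of _ 1])
        show "AE \<omega> in M. norm (D n \<omega>) \<le> 1"
          using D_values[of _ n] by (intro AE_I2) fastforce
      qed simp
    qed simp
    have "AE \<omega> in M. real_cond_exp M (F n) (\<lambda>_. 1 :: real) \<omega> = 1"
      by (intro real_cond_exp_F_meas) auto
    with real_cond_exp_diff[OF int] draw[of n] AE_space show ?thesis
    proof eventually_elim
      case (elim \<omega>)
      have pos: "0 < b + (\<Sum>i<n. W i \<omega>)"
        using Y_pos[OF elim(3), of n] by (simp add: Y_def)
      have "(\<Sum>i<n. W i \<omega> * (1 - D i \<omega>)) = (\<Sum>i<n. W i \<omega>) - (\<Sum>i<n. W i \<omega> * D i \<omega>)"
        by (simp add: right_diff_distrib sum_subtractf)
      then show ?case using elim(1,2,4) pos by (simp add: field_simps)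
    qed
  qed
qed (use W_ge W_le in auto)

text \<open>The proportion in the exchanged urn is 1 - P n, so a limit 1 here would be a limit 0
  there.\<close>

lemma AE_P_limit_in_unit_interval:
  "AE \<omega> in M. \<exists>p. 0 < p \<and> p < 1 \<and> (\<lambda>n. P n \<omega>) \<longlonglongrightarrow> p"
proof -
  interpret flip: weighted_urn M F W "\<lambda>n \<omega>. 1 - D n \<omega>" "b - a" b C
    by (rule weighted_urn_flip)
  have flip_P: "flip.P n \<omega> = 1 - P n \<omega>" if "\<omega> \<in> space M" for n \<omega>
  proof -
    have "flip.X n \<omega> = Y n \<omega> - X n \<omega>"
      by (simp add: flip.X_def X_def Y_def right_diff_distrib sum_subtractf)
    moreover have "flip.Y n \<omega> = Y n \<omega>"
      by (simp add: flip.Y_def Y_def)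
    ultimately show ?thesis
      using Y_pos[OF that, of n] by (simp add: flip.P_def P_def diff_divide_distrib)
  qed
  show ?thesis
    using AE_convergent_P AE_not_P_tendsto_0 flip.AE_not_P_tendsto_0 AE_space
  proof eventually_elim
    case (elim \<omega>)
    obtain p where p: "(\<lambda>n. P n \<omega>) \<longlonglongrightarrow> p"
      using elim(1) unfolding convergent_def by blast
    have "0 \<le> p"
      by (rule tendsto_lowerbound[OF p]) (use P_pos[OF elim(4)] in \<open>auto intro: less_imp_le always_eventually\<close>)
    moreover have "p \<le> 1"
      by (rule tendsto_upperbound[OF p]) (use P_less_1[OF elim(4)] in \<open>auto intro: less_imp_le always_eventually\<close>)
    moreover have "p \<noteq> 0" using elim(2) p by auto
    moreover have "p \<noteq> 1"
      using elim(3) tendsto_diff[OF tendsto_const p, of 1] by (auto simp: flip_P[OF elim(4)])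
    ultimately show ?case using p by (intro exI[of _ p]) auto
  qed
qed

section \<open>Averages of draws and of products of consecutive draws\<close>

lemma AE_mean_limits:
  "AE \<omega> in M. \<exists>p. 0 < p \<and> p < 1 \<and>
     (\<lambda>n. (\<Sum>i<n. D i \<omega>) / real n) \<longlonglongrightarrow> p \<and>
     (\<lambda>n. (\<Sum>i<n. D (Suc i) \<omega> * D i \<omega>) / real n) \<longlonglongrightarrow> p * p"
proof -
  \<comment> \<open>\<open>H n\<close> is the preceding draw, which is known before draw
    \<open>n\<close>; at n = 0 there is none and the weight is 0.\<close>
  define H where "H n \<omega> = (if n = 0 then 0 else D (n - 1) \<omega>)" for n \<omega>
  have H_meas: "H n \<in> borel_measurable (F n)" for n
    using D_adapted[of "n - 1"] by (cases n) (auto simp: H_def[abs_def])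
  have H_bound: "\<bar>H n \<omega>\<bar> \<le> 1" if "\<omega> \<in> space M" for n \<omega>
    using D_values[OF that, of "n - 1"] by (auto simp: H_def)
  have "AE \<omega> in M. (\<lambda>n. (\<Sum>i<n. H i \<omega> * (D i \<omega> - P i \<omega>)) / real n) \<longlonglongrightarrow> 0"
    by (rule AE_mean_transform_tendsto_0[OF H_meas H_bound])
  moreover have "AE \<omega> in M. (\<lambda>n. (\<Sum>i<n. 1 * (D i \<omega> - P i \<omega>)) / real n) \<longlonglongrightarrow> 0"
    by (rule AE_mean_transform_tendsto_0[of _ 1]) auto
  ultimately show ?thesis
    using AE_P_limit_in_unit_interval AE_space
  proof eventually_elim
    case (elim \<omega>)
    obtain p where p: "0 < p" "p < 1" "(\<lambda>n. P n \<omega>) \<longlonglongrightarrow> p"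
      using elim(3) by blast
    have "(\<lambda>n. (\<Sum>i<n. 1 * (D i \<omega> - P i \<omega>)) / real n + (\<Sum>i<n. P i \<omega>) / real n) \<longlonglongrightarrow> 0 + p"
      by (intro tendsto_add elim(2) cesaro_mean_tendsto p(3))
    then have mean: "(\<lambda>n. (\<Sum>i<n. D i \<omega>) / real n) \<longlonglongrightarrow> p"
      by (simp add: sum_subtractf add_divide_distrib[symmetric])
    have "(\<lambda>i. D i \<omega> * (P (Suc i) \<omega> - p)) \<longlonglongrightarrow> 0"
    proof (rule Lim_null_comparison)
      show "\<forall>\<^sub>F i in sequentially. norm (D i \<omega> * (P (Suc i) \<omega> - p)) \<le> \<bar>P (Suc i) \<omega> - p\<bar>"
      proof (intro always_eventually allI)
        show "norm (D i \<omega> * (P (Suc i) \<omega> - p)) \<le> \<bar>P (Suc i) \<omega> - p\<bar>" for i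
          using D_values[OF elim(4), of i] by auto
      qed
      show "(\<lambda>i. \<bar>P (Suc i) \<omega> - p\<bar>) \<longlonglongrightarrow> 0"
        using LIMSEQ_Suc[OF p(3)] by (intro tendsto_rabs_zero) (simp add: LIM_zero_iff)
    qed
    then have A: "(\<lambda>n. (\<Sum>i<n. D i \<omega> * (P (Suc i) \<omega> - p)) / real n) \<longlonglongrightarrow> 0"
      by (rule cesaro_mean_tendsto)
    \<comment> \<open>The shift by one discards the artificial term with \<open>H 0\<close> and
      turns \<open>H (Suc i)\<close> into \<open>D i\<close>.\<close>
    have B: "(\<lambda>n. (\<Sum>i<n. D i \<omega> * (D (Suc i) \<omega> - P (Suc i) \<omega>)) / real n) \<longlonglongrightarrow> 0"
      using mean_tendsto_Suc[OF elim(1)] by (simp add: H_def)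
    \<comment> \<open>The second factor of D i * D (i + 1) is split into its martingale noise, the
      deviation of its conditional mean from p, and p itself.\<close>
    have "(\<lambda>n. (\<Sum>i<n. D i \<omega> * (D (Suc i) \<omega> - P (Suc i) \<omega>)) / real n
        + (\<Sum>i<n. D i \<omega> * (P (Suc i) \<omega> - p)) / real n
        + p * ((\<Sum>i<n. D i \<omega>) / real n)) \<longlonglongrightarrow> 0 + 0 + p * p"
      by (intro tendsto_add tendsto_mult tendsto_const A B mean)
    moreover have "(\<Sum>i<n. D i \<omega> * (D (Suc i) \<omega> - P (Suc i) \<omega>)) / real n
        + (\<Sum>i<n. D i \<omega> * (P (Suc i) \<omega> - p)) / real n
        + p * ((\<Sum>i<n. D i \<omega>) / real n) = (\<Sum>i<n. D (Suc i) \<omega> * D i \<omega>) / real n" for n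
      by (simp add: add_divide_distrib[symmetric] sum_distrib_left sum.distrib[symmetric] algebra_simps)
    ultimately have "(\<lambda>n. (\<Sum>i<n. D (Suc i) \<omega> * D i \<omega>) / real n) \<longlonglongrightarrow> p * p"
      by simp
    then show ?case using p mean by blast
  qed
qed

end

subsection \<open>Erosion networks\<close>

text \<open>A switch indicator expands to the sum of two consecutive choices minus twice their
  product. Up to time n + 1 there are n comparisons, which matches the normalisation.\<close>

lemma switching_rate_Suc:
  "switching_rate D v (Suc n) \<omega> =
     (\<Sum>i<n. D v (Suc (Suc i)) \<omega>) / real n + (\<Sum>i<n. D v (Suc i) \<omega>) / real n
     - 2 * ((\<Sum>i<n. D v (Suc (Suc i)) \<omega> * D v (Suc i) \<omega>) / real n)"
proof -
  have "(\<Sum>i = 2..Suc n. switch D v i \<omega>) = (\<Sum>i<n. switch D v (Suc (Suc i)) \<omega>)"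
  proof (induction n)
    case (Suc n)
    then show ?case by simp
  qed simp
  also have "\<dots> = (\<Sum>i<n. D v (Suc (Suc i)) \<omega> + D v (Suc i) \<omega>
      - 2 * (D v (Suc (Suc i)) \<omega> * D v (Suc i) \<omega>))"
    by (intro sum.cong) (auto simp: switch_def algebra_simps)
  finally show ?thesis
    unfolding switching_rate_def
    by (simp add: sum.distrib sum_subtractf sum_distrib_left[symmetric] add_divide_distrib diff_divide_distrib)
qed

lemma parents_in_Z2_even:
  assumes "v \<in> Z2_even" "depth v \<noteq> 1"
  shows "left_parent v \<in> Z2_even" "right_parent v \<in> Z2_even"
  using assms by (auto simp: Z2_even_def depth_def left_parent_def right_parent_def)

context erosion_network
begin

lemma space_history: "space (history M D n) = space M"
  using subalgebra_history[of n] by (simp add: subalgebra_def)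

lemma sets_history_mono:
  assumes "m \<le> n"
  shows "sets (history M D m) \<subseteq> sets (history M D n)"
proof -
  have "{D u k -` B \<inter> space M | u k B. u \<in> Z2_even \<and> 1 \<le> k \<and> k \<le> m \<and> B \<in> sets borel}
      \<subseteq> {D u k -` B \<inter> space M | u k B. u \<in> Z2_even \<and> 1 \<le> k \<and> k \<le> n \<and> B \<in> sets borel}"
    using assms by (blast intro: order_trans)
  then show ?thesis
    unfolding history_def by (subst (1 2) sets_measure_of) (auto intro!: sigma_sets_mono')
qed

lemma measurable_history_mono:
  assumes "m \<le> n" "f \<in> borel_measurable (history M D m)"
  shows "f \<in> borel_measurable (history M D n)"
proof -
  have "subalgebra (history M D n) (history M D m)"
    using sets_history_mono[OF assms(1)] by (simp add: subalgebra_def space_history)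
  then show ?thesis using assms(2) by (rule measurable_from_subalg)
qed

lemma D_measurable_history:
  assumes "u \<in> Z2_even" "1 \<le> k" "k \<le> n"
  shows "D u k \<in> borel_measurable (history M D n)"
proof (rule measurableI)
  fix B :: "real set" assume "B \<in> sets borel"
  then have "D u k -` B \<inter> space M \<in> sets (history M D n)"
    unfolding history_def using assms by (intro in_measure_of) blast+
  then show "D u k -` B \<inter> space (history M D n) \<in> sets (history M D n)"
    by (simp add: space_history)
qed simp

text \<open>The flow at time n depends on choices up to time n only, so it is known before the
  choice at time n + 1. The induction is on time for all nodes at once, since a step passes to the
  parents.\<close>

lemma I_flow_measurable:
  assumes "v \<in> Z2_even"
  shows "I_flow D v n \<in> borel_measurable (history M D n)"
  using assms
proof (induction n arbitrary: v)
  case 0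
  then show ?case by simp
next
  case (Suc n)
  show ?case
  proof (cases "depth v = 1")
    case False
    note par = parents_in_Z2_even[OF Suc.prems False]
    note [measurable] = par[THEN Suc.IH, THEN measurable_history_mono[rotated], OF le_SucI[OF order_refl]]
      par[THEN D_measurable_history, of "Suc n" "Suc n", simplified]
    show ?thesis using False by simp
  qed simp
qed

text \<open>The added unit gives the lower bound. For the upper bound a node receives at most the
  flows of both parents plus 1, and 2 (2^(d-1) - 1) + 1 = 2^d - 1 for depth d.\<close>

lemma I_flow_bounds:
  assumes "v \<in> Z2_even" "\<omega> \<in> space M"
  shows "1 \<le> I_flow D v n \<omega> \<and> I_flow D v n \<omega> \<le> 2 ^ nat (depth v) - 1"
  using assms(1)
proof (induction n arbitrary: v)
  case 0
  then have "nat (depth v) \<ge> 1" by (auto simp: Z2_even_def depth_def)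
  then have "(2::real) ^ 1 \<le> 2 ^ nat (depth v)" by (intro power_increasing) auto
  then show ?case by simp
next
  case (Suc n)
  show ?case
  proof (cases "depth v = 1")
    case False
    note par = parents_in_Z2_even[OF Suc.prems False]
    have "depth v \<ge> 2" using Suc.prems False by (auto simp: Z2_even_def depth_def)
    then have "nat (depth v) = Suc (nat (depth v - 1))" by simp
    moreover have "depth (left_parent v) = depth v - 1" "depth (right_parent v) = depth v - 1"
      by (auto simp: depth_def left_parent_def right_parent_def)
    ultimately show ?thesis
      using False Suc.IH[OF par(1)] Suc.IH[OF par(2)]
        D_values[OF par(1) _ assms(2), of "Suc n"] D_values[OF par(2) _ assms(2), of "Suc n"]
      by auto
  qed simp
qed

text \<open>Draw \<open>n\<close> of the urn is the choice at time n + 1, with reinforcement and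
  history taken at time n. The initial weights \<eta> and 2 * \<eta> make the urn proportion equal
  to \<open>P_left\<close>.\<close>

lemma weighted_urn_node:
  assumes v: "v \<in> Z2_even"
  shows "weighted_urn M (history M D) (I_flow D v) (\<lambda>n. D v (Suc n)) \<eta> (2 * \<eta>) (2 ^ nat (depth v) - 1)"
proof unfold_locales
  show "subalgebra M (history M D n)" "sets (history M D n) \<subseteq> sets (history M D (Suc n))"
    "I_flow D v n \<in> borel_measurable (history M D n)"
    "D v (Suc n) \<in> borel_measurable (history M D (Suc n))" for n
    by (auto intro!: subalgebra_history sets_history_mono I_flow_measurable D_measurable_history v simp del: One_nat_def)
  show "D v (Suc n) \<omega> \<in> {0, 1}" if "\<omega> \<in> space M" for n \<omega>
    by (rule D_values[OF v _ that]) simp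
  show "1 \<le> I_flow D v n \<omega>" "I_flow D v n \<omega> \<le> 2 ^ nat (depth v) - 1" if "\<omega> \<in> space M" for n \<omega>
    using I_flow_bounds[OF v that] by auto
  show "0 < \<eta>" "\<eta> < 2 * \<eta>" using eta_pos by auto
  show "AE \<omega> in M. real_cond_exp M (history M D n) (D v (Suc n)) \<omega> =
      (\<eta> + (\<Sum>i<n. I_flow D v i \<omega> * D v (Suc i) \<omega>)) / (2 * \<eta> + (\<Sum>i<n. I_flow D v i \<omega>))" for n
  proof -
    interpret finite_measure_subalgebra M "history M D n"
      by unfold_locales (rule subalgebra_history)
    have [measurable]: "D v (Suc n) \<in> borel_measurable M"
      by (rule D_measurable[OF v]) simp
    \<comment> \<open>The model prescribes the conditional probability of choosing left, while the
      urn needs the conditional mean of the choice; the two agree for values in {0, 1}.\<close>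
    have "AE \<omega> in M. real_cond_exp M (history M D n) (D v (Suc n)) \<omega> =
        real_cond_exp M (history M D n) (indicator {\<omega> \<in> space M. D v (Suc n) \<omega> = 1}) \<omega>"
    proof (rule real_cond_exp_cong)
      show "AE \<omega> in M. D v (Suc n) \<omega> = indicator {\<omega> \<in> space M. D v (Suc n) \<omega> = 1} \<omega>"
      proof (intro AE_I2)
        fix \<omega> assume "\<omega> \<in> space M"
        then show "D v (Suc n) \<omega> = indicator {\<omega> \<in> space M. D v (Suc n) \<omega> = 1} \<omega>"
          using D_values[OF v, of "Suc n" \<omega>] by (auto simp: indicator_def)
      qed
    qed measurable
    moreover have "T_left D v n \<omega> = (\<Sum>i<n. I_flow D v i \<omega> * D v (Suc i) \<omega>)"
      "T_total D v n \<omega> = (\<Sum>i<n. I_flow D v i \<omega>)" for \<omega>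
      by (induction n) simp_all
    ultimately show ?thesis
      using D_cond_prob[OF v, of "Suc n"] by (auto simp: P_left_def add.commute)
  qed
qed

end

theorem corollary3p13:
  fixes M :: "'a measure" and \<eta> :: real
    and D :: "node \<Rightarrow> nat \<Rightarrow> 'a \<Rightarrow> real" and v :: node
  assumes "erosion_network M \<eta> D"
    and "v \<in> Z2_even"
  shows "(AE \<omega> in M. convergent (\<lambda>n. switching_rate D v n \<omega>) \<and>
                     lim (\<lambda>n. switching_rate D v n \<omega>) \<noteq> 0) \<and>
         (AE \<omega> in M. infinite {n. n \<ge> 1 \<and> D v n \<omega> = 1} \<and>
                     infinite {n. n \<ge> 1 \<and> D v n \<omega> = 0})"
proof -
  interpret erosion_network M \<eta> D by fact
  interpret urn: weighted_urn M "history M D" "I_flow D v" "\<lambda>n. D v (Suc n)" \<eta> "2 * \<eta>"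
      "2 ^ nat (depth v) - 1"
    by (rule weighted_urn_node) fact
  show ?thesis
    \<comment> \<open>Both claims are proved on one common event of probability 1, as both follow
      from the same limit p.\<close>
    unfolding AE_conj_iff[symmetric]
    using urn.AE_mean_limits AE_space
  proof eventually_elim
    case (elim \<omega>)
    then obtain p where p: "0 < p" "p < 1"
      and mean: "(\<lambda>n. (\<Sum>i<n. D v (Suc i) \<omega>) / real n) \<longlonglongrightarrow> p"
      and pairs: "(\<lambda>n. (\<Sum>i<n. D v (Suc (Suc i)) \<omega> * D v (Suc i) \<omega>) / real n) \<longlonglongrightarrow> p * p"
      by blast
    have "(\<lambda>n. switching_rate D v (Suc n) \<omega>) \<longlonglongrightarrow> p + p - 2 * (p * p)"
      unfolding switching_rate_Suc
      by (intro tendsto_add tendsto_diff tendsto_mult tendsto_const mean pairs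
          mean_tendsto_Suc[OF mean])
    then have rate: "(\<lambda>n. switching_rate D v n \<omega>) \<longlonglongrightarrow> p + p - 2 * (p * p)"
      by (rule LIMSEQ_imp_Suc)
    have "p + p - 2 * (p * p) = 2 * p * (1 - p)"
      by (simp add: algebra_simps)
    with p have "p + p - 2 * (p * p) \<noteq> 0"
      by simp
    with rate have "convergent (\<lambda>n. switching_rate D v n \<omega>)"
      "lim (\<lambda>n. switching_rate D v n \<omega>) \<noteq> 0"
      by (auto simp: convergentI limI)
    \<comment> \<open>The choices average to p, which is neither 0 nor 1, so neither choice can be
      eventually permanent.\<close>
    moreover have "infinite {n. n \<ge> 1 \<and> D v n \<omega> = 1}" "infinite {n. n \<ge> 1 \<and> D v n \<omega> = 0}"
      using infinite_values_of_mean[OF mean, of 1 0] infinite_values_of_mean[OF mean, of 0 1]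
        D_values[OF assms(2) _ elim(2)] p by auto
    ultimately show ?case by blast
  qed
qed

end
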